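(* Let $m\ge 3$, let $x_1^0,\dots,x_m^0$ be the quantile functions of a basic tuple with constants $r,R$, let $\lambda> 1+R/r$, $\varepsilon=1/\lambda$, and let $A^{(\infty)}$ be the infinite generation of quantile functions (all as defined in the context). Then $$A^{(\infty)}=\bigsqcup_{i=1}^m A^{(\infty)}_i,\qquad A^{(\infty)}_i=\varepsilon x_i^0+\varepsilon A^{(\infty)},\quad 1\le i\le m,$$ where $\sqcup$ denotes disjoint union. Hence $A^{(\infty)}$ consists of $m$ disjoint parts similar to the entire set with similarity coefficient $\varepsilon=1/\lambda$, so that it is a fractal with similarity dimension $$d=\frac{\ln m}{\ln\lambda},\qquad\text{and}\qquad d<\frac{\ln m}{\ln(1+R/r)}.$$
   Context: Quantile function of a random variable $X$: $x(u)=\inf\{x:\mathbf P(X\le x)\ge u\}$, $u\in(0,1)$. For random variables, $X\prec Y$ ($X$ stochastically precedes $Y$) means $\mathbf E\,\mathrm{sign}(Y-X)>0$, i.e. $\mathbf P(X<Y)>\mathbf P(X>Y)$. Basic tuple: independent random variables $X_1^0,\dots,X_m^0$, $m\ge3$, with quantile functions $x_1^0,\dots,x_m^0$, such that $X_1^0\prec X_2^0\prec\dots\prec X_m^0\prec X_1^0$ and $$\inf_{u_1,u_2\in(0,1)}\min_{i_1\ne i_2}|x^0_{i_1}(u_1)-x^0_{i_2}(u_2)|=r>0,\qquad \sup_{u_1,u_2\in(0,1)}\max_{i_1\ne i_2}|x^0_{i_1}(u_1)-x^0_{i_2}(u_2)|=R<\infty.$$ Infinite generation: $A^{(\infty)}$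 is the set of functions with infinite indexes $i_1\dots i_l\dots\in\{1,\dots,m\}^{\mathbb N}$ given by $x_{i_1\dots i_l\dots}(u)=\sum_{l=1}^\infty\varepsilon^l x^0_{i_l}(u)$, $u\in(0,1)$. $A^{(\infty)}_i$ is the subset of functions in $A^{(\infty)}$ whose index starts with $i$. For a function $a$, a number $b>0$ and a set $M$ of functions, $a+bM=\{a+bx:x\in M\}$. Similarity dimension: if a set is a disjoint union of $m$ parts, each similar to the entire set with the same similarity coefficient $\varepsilon\in(0,1)$, its similarity dimension (for this decomposition) is $\ln m/\ln(1/\varepsilon)$. *)

theory Defs
  imports "HOL-Probability.Probability"
begin

text \<open>Functions of \<open>u \<in> (0,1)\<close> are rendered as functions on \<open>real\<close> that are \<open>extensional\<close> on
  \<open>{0<..<1}\<close>, so that HOL equality is equality on \<open>(0,1)\<close>.\<close>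

definition quantile :: "'a measure \<Rightarrow> ('a \<Rightarrow> real) \<Rightarrow> real \<Rightarrow> real" where
  "quantile M X = (\<lambda>u\<in>{0<..<1}. Inf {x. \<P>(\<omega> in M. X \<omega> \<le> x) \<ge> u})"

definition stoch_precedes :: "'a measure \<Rightarrow> ('a \<Rightarrow> real) \<Rightarrow> ('a \<Rightarrow> real) \<Rightarrow> bool" where
  "stoch_precedes M X Y \<longleftrightarrow> (\<integral>\<omega>. sgn (Y \<omega> - X \<omega>) \<partial>M) > 0"

definition distinct_pairs :: "nat \<Rightarrow> (nat \<times> nat) set" where
  "distinct_pairs m = {(i, j). i \<in> {1..m} \<and> j \<in> {1..m} \<and> i \<noteq> j}"

text \<open>The infimum and supremum are taken in \<open>ereal\<close>: equality of the supremum with a real \<open>R\<close>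
  then really says that it is finite, whereas \<open>Sup\<close> on \<open>real\<close> is unspecified on unbounded sets.\<close>

definition basic_tuple :: "'a measure \<Rightarrow> nat \<Rightarrow> (nat \<Rightarrow> 'a \<Rightarrow> real) \<Rightarrow> real \<Rightarrow> real \<Rightarrow> bool" where
  "basic_tuple M m X r R \<longleftrightarrow>
     prob_space M \<and> m \<ge> 3 \<and>
     prob_space.indep_vars M (\<lambda>_. borel) X {1..m} \<and>
     (\<forall>i\<in>{1..<m}. stoch_precedes M (X i) (X (i + 1))) \<and> stoch_precedes M (X m) (X 1) \<and>
     (INF u1\<in>{0<..<1}. INF u2\<in>{0<..<1}.
        ereal (MIN (i, j)\<in>distinct_pairs m. \<bar>quantile M (X i) u1 - quantile M (X j) u2\<bar>)) = ereal r \<and>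
     r > 0 \<and>
     (SUP u1\<in>{0<..<1}. SUP u2\<in>{0<..<1}.
        ereal (MAX (i, j)\<in>distinct_pairs m. \<bar>quantile M (X i) u1 - quantile M (X j) u2\<bar>)) = ereal R"

text \<open>Index sequences are counted from 0: \<open>\<iota> l\<close> stands for \<open>i\<^bsub>l+1\<^esub>\<close>.  The series converges whenever
  \<open>0 < eps < 1\<close>, see \<open>series_fun_summable\<close> below.\<close>

definition series_fun :: "real \<Rightarrow> (nat \<Rightarrow> real \<Rightarrow> real) \<Rightarrow> (nat \<Rightarrow> nat) \<Rightarrow> real \<Rightarrow> real" where
  "series_fun eps x \<iota> = (\<lambda>u\<in>{0<..<1}. \<Sum>l. eps ^ Suc l * x (\<iota> l) u)"

definition inf_gen :: "nat \<Rightarrow> real \<Rightarrow> (nat \<Rightarrow> real \<Rightarrow> real) \<Rightarrow> (real \<Rightarrow> real) set" where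
  "inf_gen m eps x = {series_fun eps x \<iota> |\<iota>. \<iota> \<in> UNIV \<rightarrow> {1..m}}"

definition inf_gen_part :: "nat \<Rightarrow> real \<Rightarrow> (nat \<Rightarrow> real \<Rightarrow> real) \<Rightarrow> nat \<Rightarrow> (real \<Rightarrow> real) set" where
  "inf_gen_part m eps x i = {series_fun eps x \<iota> |\<iota>. \<iota> \<in> UNIV \<rightarrow> {1..m} \<and> \<iota> 0 = i}"

text \<open>The set \<open>a + b M = {a + b x : x \<in> M}\<close>.\<close>

definition affine_set :: "(real \<Rightarrow> real) \<Rightarrow> real \<Rightarrow> (real \<Rightarrow> real) set \<Rightarrow> (real \<Rightarrow> real) set" where
  "affine_set a b M = {\<lambda>u\<in>{0<..<1}. a u + b * x u |x. x \<in> M}"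

definition similar_with :: "real \<Rightarrow> (real \<Rightarrow> real) set \<Rightarrow> (real \<Rightarrow> real) set \<Rightarrow> bool" where
  "similar_with b P M \<longleftrightarrow> b > 0 \<and> (\<exists>a. P = affine_set a b M)"

text \<open>\<open>d\<close> is the similarity dimension of \<open>M\<close> for its decomposition into the parts \<open>P 1, \<dots>, P m\<close>.
  Nonemptiness of \<open>M\<close>, hence of all parts, makes the number of parts meaningful.\<close>

definition has_similarity_dimension ::
  "(real \<Rightarrow> real) set \<Rightarrow> nat \<Rightarrow> (nat \<Rightarrow> (real \<Rightarrow> real) set) \<Rightarrow> real \<Rightarrow> real \<Rightarrow> bool" where
  "has_similarity_dimension M m P eps d \<longleftrightarrow>
     M \<noteq> {} \<and> 0 < eps \<and> eps < 1 \<and>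
     M = (\<Union>i\<in>{1..m}. P i) \<and> disjoint_family_on P {1..m} \<and>
     (\<forall>i\<in>{1..m}. similar_with eps (P i) M) \<and>
     d = ln (real m) / ln (1 / eps)"

lemma series_fun_summable:
  fixes x :: "nat \<Rightarrow> real \<Rightarrow> real"
  assumes eps: "0 < eps" "eps < 1" and \<iota>: "\<iota> \<in> UNIV \<rightarrow> {1..m}"
  shows "summable (\<lambda>l. eps ^ Suc l * x (\<iota> l) u)"
proof (rule summable_comparison_test')
  define C where "C = (\<Sum>i\<in>{1..m}. \<bar>x i u\<bar>)"
  show "summable (\<lambda>l. C * eps ^ Suc l)"
    using eps by (intro summable_mult) (simp add: summable_Suc_iff summable_geometric)
  show "norm (eps ^ Suc l * x (\<iota> l) u) \<le> C * eps ^ Suc l" if "l \<ge> 0" for l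
  proof -
    have "\<iota> l \<in> {1..m}" using \<iota> by blast
    then have "\<bar>x (\<iota> l) u\<bar> \<le> C"
      unfolding C_def by (rule member_le_sum) simp_all
    then have "\<bar>x (\<iota> l) u\<bar> * eps ^ Suc l \<le> C * eps ^ Suc l"
      using eps by (intro mult_right_mono) simp_all
    then show ?thesis using eps by (simp add: abs_mult ac_simps)
  qed
qed

end

(* Idea: shifting the index sequence gives A_i = eps x_i + eps A.  Two elements of A differ by at most
   eps R / (1 - eps) = R / (lam - 1) < r at any point u of (0,1), while x_i and x_j differ there by
   at least r, so eps x_i + eps A and eps x_j + eps A cannot meet. *)

theory Submission
  imports Defs
begin

text \<open>Turns the nested \<open>INF\<close> and \<open>SUP\<close> in \<open>ereal\<close> into
  real bounds for a single pair of points: the infimum lies below its value at \<open>u\<close>,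
  \<open>v\<close>, which is a \<open>Min\<close> over finitely many pairs and so lies below the
  entry of \<open>(i, j)\<close>; dually for the supremum and \<open>Max\<close>.\<close>

lemma basic_tuple_quantile_dist:
  assumes bt: "basic_tuple M m X r R"
    and u: "u \<in> {0<..<1}" "v \<in> {0<..<1}"
    and ij: "i \<in> {1..m}" "j \<in> {1..m}" "i \<noteq> j"
  shows "r \<le> \<bar>quantile M (X i) u - quantile M (X j) v\<bar>"
    and "\<bar>quantile M (X i) u - quantile M (X j) v\<bar> \<le> R"
proof -
  let ?D = "\<lambda>u v. (\<lambda>(i, j). \<bar>quantile M (X i) u - quantile M (X j) v\<bar>) ` distinct_pairs m"
  let ?d = "\<bar>quantile M (X i) u - quantile M (X j) v\<bar>"
  have "finite (distinct_pairs m)"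
    by (rule finite_subset[of _ "{1..m} \<times> {1..m}"]) (auto simp: distinct_pairs_def)
  then have fin: "finite (?D u v)" by simp
  have mem: "?d \<in> ?D u v"
    using ij by (force simp: distinct_pairs_def)
  have "ereal r = (INF u\<in>{0<..<1}. INF v\<in>{0<..<1}. ereal (Min (?D u v)))"
    using bt by (simp add: basic_tuple_def)
  also have "\<dots> \<le> ereal (Min (?D u v))"
    by (rule INF_lower2[OF u(1)], rule INF_lower2[OF u(2)]) simp
  also have "\<dots> \<le> ereal ?d"
    using Min_le[OF fin mem] by simp
  finally show "r \<le> ?d" by simp
  have "ereal ?d \<le> ereal (Max (?D u v))"
    using Max_ge[OF fin mem] by simp
  also have "\<dots> \<le> (SUP u\<in>{0<..<1}. SUP v\<in>{0<..<1}. ereal (Max (?D u v)))"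
    by (rule SUP_upper2[OF u(1)], rule SUP_upper2[OF u(2)]) simp
  also have "\<dots> = ereal R"
    using bt by (simp add: basic_tuple_def)
  finally show "?d \<le> R" by simp
qed

lemma inf_gen_nonempty: "1 \<le> m \<Longrightarrow> inf_gen m eps x \<noteq> {}"
  by (auto simp: inf_gen_def intro!: exI[of _ "\<lambda>_. 1"])

lemma inf_gen_eq_Union_parts: "inf_gen m eps x = (\<Union>i\<in>{1..m}. inf_gen_part m eps x i)"
proof (intro equalityI subsetI)
  fix f assume "f \<in> inf_gen m eps x"
  then obtain \<iota> where \<iota>: "f = series_fun eps x \<iota>" "\<iota> \<in> UNIV \<rightarrow> {1..m}"
    by (auto simp: inf_gen_def)
  then have "f \<in> inf_gen_part m eps x (\<iota> 0)"
    unfolding inf_gen_part_def by blast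
  with \<iota>(2) show "f \<in> (\<Union>i\<in>{1..m}. inf_gen_part m eps x i)"
    by blast
qed (auto simp: inf_gen_def inf_gen_part_def)

text \<open>Split off the term l = 0. As the exponent is \<open>Suc l\<close>, this head carries one
  factor \<open>eps\<close>, and every later term still has a spare factor \<open>eps\<close> that
  can be pulled out.\<close>

lemma series_fun_shift:
  assumes "0 < eps" "eps < 1" and \<iota>: "\<iota> \<in> UNIV \<rightarrow> {1..m}"
  shows "series_fun eps x \<iota> =
    (\<lambda>u\<in>{0<..<1}. eps * x (\<iota> 0) u + eps * series_fun eps x (\<lambda>l. \<iota> (Suc l)) u)"
proof (rule ext)
  fix u
  have sum: "summable (\<lambda>l. eps ^ Suc l * x (\<iota> l) u)"
    by (rule series_fun_summable[OF assms])
  \<comment> \<open>Convergence of the tail series is what allows \<open>eps\<close> to be moved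
    outside the sum.\<close>
  have "summable (\<lambda>l. eps ^ Suc l * x (\<iota> (Suc l)) u)"
    using assms by (intro series_fun_summable[of _ "\<lambda>l. \<iota> (Suc l)" m]) auto
  then have "(\<Sum>l. eps ^ Suc (Suc l) * x (\<iota> (Suc l)) u)
      = eps * (\<Sum>l. eps ^ Suc l * x (\<iota> (Suc l)) u)"
    by (subst suminf_mult[symmetric]) (auto simp: mult.assoc)
  \<comment> \<open>Outside (0,1) both sides are \<open>undefined\<close>, so the equation holds at
    every real \<open>u\<close>.\<close>
  then show "series_fun eps x \<iota> u =
      (\<lambda>u\<in>{0<..<1}. eps * x (\<iota> 0) u + eps * series_fun eps x (\<lambda>l. \<iota> (Suc l)) u) u"
    using suminf_split_head[OF sum] by (auto simp: series_fun_def restrict_def)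
qed

text \<open>Deleting the first index and prepending \<open>i\<close> are inverse operations between
  the sequences that start with \<open>i\<close> and all sequences; \<open>series_fun_shift\<close>
  translates them into the affine map.\<close>

lemma inf_gen_part_eq_affine_set:
  assumes eps: "0 < eps" "eps < 1" and i: "i \<in> {1..m}"
  shows "inf_gen_part m eps x i = affine_set (\<lambda>u. eps * x i u) eps (inf_gen m eps x)"
proof (intro equalityI subsetI)
  fix f assume "f \<in> inf_gen_part m eps x i"
  then obtain \<iota> where \<iota>: "f = series_fun eps x \<iota>" "\<iota> \<in> UNIV \<rightarrow> {1..m}" "\<iota> 0 = i"
    by (auto simp: inf_gen_part_def)
  moreover have "series_fun eps x (\<lambda>l. \<iota> (Suc l)) \<in> inf_gen m eps x"
    unfolding inf_gen_def using \<iota>(2) by blast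
  ultimately show "f \<in> affine_set (\<lambda>u. eps * x i u) eps (inf_gen m eps x)"
    unfolding affine_set_def using series_fun_shift[OF eps \<iota>(2)] by blast
next
  fix f assume "f \<in> affine_set (\<lambda>u. eps * x i u) eps (inf_gen m eps x)"
  then obtain \<kappa> where \<kappa>: "\<kappa> \<in> UNIV \<rightarrow> {1..m}"
    and f: "f = (\<lambda>u\<in>{0<..<1}. eps * x i u + eps * series_fun eps x \<kappa> u)"
    by (auto simp: affine_set_def inf_gen_def)
  \<comment> \<open>The sequence i, \<kappa> 0, \<kappa> 1, ...: its head is \<open>i\<close> and
    its shift is \<open>\<kappa>\<close>.\<close>
  let ?\<iota> = "case_nat i \<kappa>"
  have \<iota>: "?\<iota> \<in> UNIV \<rightarrow> {1..m}"
    using \<kappa> i by (auto simp: Pi_iff split: nat.split)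
  have "f = series_fun eps x ?\<iota>"
    using series_fun_shift[OF eps \<iota>, of x] f by simp
  then show "f \<in> inf_gen_part m eps x i"
    unfolding inf_gen_part_def using \<iota> by force
qed

text \<open>Subtract the two series termwise and compare with a geometric series. The bound
  \<open>R\<close> is also required for \<open>i = j\<close>, since two index sequences may agree at
  some positions.\<close>

lemma inf_gen_pointwise_dist:
  assumes eps: "0 < eps" "eps < 1" and u: "u \<in> {0<..<1}"
    and R: "\<And>i j. i \<in> {1..m} \<Longrightarrow> j \<in> {1..m} \<Longrightarrow> \<bar>x i u - x j u\<bar> \<le> R"
    and g: "g \<in> inf_gen m eps x" and h: "h \<in> inf_gen m eps x"
  shows "\<bar>g u - h u\<bar> \<le> eps * R / (1 - eps)"
proof -
  obtain \<iota> \<kappa> where \<iota>: "\<iota> \<in> UNIV \<rightarrow> {1..m}" "g = series_fun eps x \<iota>"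
    and \<kappa>: "\<kappa> \<in> UNIV \<rightarrow> {1..m}" "h = series_fun eps x \<kappa>"
    using g h by (auto simp: inf_gen_def)
  let ?d = "\<lambda>l. eps ^ Suc l * x (\<iota> l) u - eps ^ Suc l * x (\<kappa> l) u"
  have "?d sums (g u - h u)"
    using sums_diff[OF series_fun_summable[OF eps \<iota>(1), THEN summable_sums]
        series_fun_summable[OF eps \<kappa>(1), THEN summable_sums]] u
    by (simp add: \<iota>(2) \<kappa>(2) series_fun_def)
  moreover have bound: "norm (?d l) \<le> eps * R * eps ^ l" for l
  proof -
    have "norm (?d l) = eps ^ Suc l * \<bar>x (\<iota> l) u - x (\<kappa> l) u\<bar>"
      using eps by (simp add: right_diff_distrib[symmetric] abs_mult)
    also have "\<dots> \<le> eps ^ Suc l * R"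
      using eps \<iota>(1) \<kappa>(1) by (intro mult_left_mono R) auto
    finally show ?thesis by (simp add: mult_ac)
  qed
  moreover have geom: "(\<lambda>l. eps * R * eps ^ l) sums (eps * R * (1 / (1 - eps)))"
    using eps by (intro sums_mult geometric_sums) simp
  ultimately show ?thesis
    using norm_suminf_le[OF bound sums_summable[OF geom]] by (simp add: sums_iff)
qed

text \<open>Separation at one point \<open>u\<close> suffices: a common element would force
  \<open>x i u - x j u = h u - g u\<close> for some \<open>g\<close>, \<open>h\<close> in the whole
  set, where the left side is at least \<open>r\<close> in absolute value and the right side is
  smaller.\<close>

lemma disjoint_inf_gen_parts:
  assumes eps: "0 < eps" "eps < 1" and u: "u \<in> {0<..<1}"
    and R: "\<And>i j. i \<in> {1..m} \<Longrightarrow> j \<in> {1..m} \<Longrightarrow> \<bar>x i u - x j u\<bar> \<le> R"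
    and r: "\<And>i j. i \<in> {1..m} \<Longrightarrow> j \<in> {1..m} \<Longrightarrow> i \<noteq> j \<Longrightarrow> r \<le> \<bar>x i u - x j u\<bar>"
    and less: "eps * R / (1 - eps) < r"
  shows "disjoint_family_on (inf_gen_part m eps x) {1..m}"
proof (unfold disjoint_family_on_def, intro ballI impI, rule ccontr)
  fix i j assume ij: "i \<in> {1..m}" "j \<in> {1..m}" "i \<noteq> j"
  assume "inf_gen_part m eps x i \<inter> inf_gen_part m eps x j \<noteq> {}"
  then obtain f where f: "f \<in> affine_set (\<lambda>u. eps * x i u) eps (inf_gen m eps x)"
    "f \<in> affine_set (\<lambda>u. eps * x j u) eps (inf_gen m eps x)"
    using inf_gen_part_eq_affine_set[OF eps] ij by blast
  obtain g where g: "g \<in> inf_gen m eps x" "f u = eps * x i u + eps * g u"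
    using f(1) u by (auto simp: affine_set_def)
  obtain h where h: "h \<in> inf_gen m eps x" "f u = eps * x j u + eps * h u"
    using f(2) u by (auto simp: affine_set_def)
  have "eps * (x i u + g u) = eps * (x j u + h u)"
    using g(2) h(2) by (simp add: distrib_left)
  then have "x i u + g u = x j u + h u"
    using eps by simp
  moreover have "\<bar>g u - h u\<bar> \<le> eps * R / (1 - eps)"
    using eps u R g(1) h(1) by (rule inf_gen_pointwise_dist)
  ultimately show False
    using r[OF ij] less by linarith
qed

theorem mainTheorem11:
  fixes M :: "'a measure" and X :: "nat \<Rightarrow> 'a \<Rightarrow> real" and m :: nat
    and r R lam eps :: real and x :: "nat \<Rightarrow> real \<Rightarrow> real"
  assumes "basic_tuple M m X r R"
    and "x = (\<lambda>i. quantile M (X i))"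
    and "lam > 1 + R / r"
    and "eps = 1 / lam"
  shows "inf_gen m eps x = (\<Union>i\<in>{1..m}. inf_gen_part m eps x i)
    \<and> disjoint_family_on (inf_gen_part m eps x) {1..m}
    \<and> (\<forall>i\<in>{1..m}. inf_gen_part m eps x i = affine_set (\<lambda>u. eps * x i u) eps (inf_gen m eps x))
    \<and> has_similarity_dimension (inf_gen m eps x) m (inf_gen_part m eps x) eps
           (ln (real m) / ln lam)
    \<and> ln (real m) / ln lam < ln (real m) / ln (1 + R / r)"
proof -
  have m: "3 \<le> m" and r: "0 < r"
    using assms(1) by (auto simp: basic_tuple_def)
  \<comment> \<open>Any point of (0,1) would serve.\<close>
  define u :: real where "u = 1 / 2"
  have u: "u \<in> {0<..<1}" by (simp add: u_def)
  have lower: "r \<le> \<bar>x i u - x j u\<bar>" and upper: "\<bar>x i u - x j u\<bar> \<le> R"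
    if "i \<in> {1..m}" "j \<in> {1..m}" "i \<noteq> j" for i j
    using basic_tuple_quantile_dist[OF assms(1) u u that] by (auto simp: assms(2))
  \<comment> \<open>The indices 1 and 2 are distinct and admissible, so \<open>r\<close> \<le>
    \<open>R\<close>.\<close>
  have R: "0 < R"
    using lower[of 1 2] upper[of 1 2] m r by simp
  have "0 < R / r" using R r by simp
  then have lam: "1 < lam" using assms(3) by linarith
  then have eps: "0 < eps" "eps < 1" by (simp_all add: assms(4))
  \<comment> \<open>Here the threshold for \<open>lam\<close> enters: for \<open>lam > 1\<close> and
    \<open>r > 0\<close>, \<open>R / (lam - 1) < r\<close> is equivalent to
    \<open>lam > 1 + R / r\<close>.\<close>
  have "eps * R / (1 - eps) = R / (lam - 1)"
    using lam by (simp add: assms(4) field_simps)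
  also have "\<dots> < r"
    using assms(3) lam r by (simp add: field_simps)
  finally have less: "eps * R / (1 - eps) < r" .
  \<comment> \<open>For equal indices the difference is 0, and \<open>R\<close> is positive.\<close>
  have upper': "\<bar>x i u - x j u\<bar> \<le> R" if "i \<in> {1..m}" "j \<in> {1..m}" for i j
    using upper[OF that] R by (cases "i = j") auto
  have disj: "disjoint_family_on (inf_gen_part m eps x) {1..m}"
    using eps u upper' lower less by (rule disjoint_inf_gen_parts)
  have affine: "\<forall>i\<in>{1..m}. inf_gen_part m eps x i
      = affine_set (\<lambda>u. eps * x i u) eps (inf_gen m eps x)"
    using inf_gen_part_eq_affine_set[OF eps] by blast
  have "\<forall>i\<in>{1..m}. similar_with eps (inf_gen_part m eps x i) (inf_gen m eps x)"
    using affine eps(1) by (metis similar_with_def)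
  then have "has_similarity_dimension (inf_gen m eps x) m (inf_gen_part m eps x) eps
      (ln (real m) / ln lam)"
    using inf_gen_nonempty[of m eps x] inf_gen_eq_Union_parts[of m eps x] m eps disj
    by (simp add: has_similarity_dimension_def assms(4))
  \<comment> \<open>Strict because \<open>ln (real m) > 0\<close> and
    \<open>0 < ln (1 + R / r) < ln lam\<close>.\<close>
  moreover have "ln (real m) / ln lam < ln (real m) / ln (1 + R / r)"
    using m lam assms(3) \<open>0 < R / r\<close>
    by (intro divide_strict_left_mono mult_pos_pos ln_gt_zero) auto
  ultimately show ?thesis
    using inf_gen_eq_Union_parts[of m eps x] disj affine by (intro conjI)
qed

end
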